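(* Let $n\ge 2$ be an integer. Let $X_1,X_2,\ldots$ be independent copies of a random variable $X$ with absolutely continuous cumulative distribution function $F$ such that $F(0)=0$ and $F(x)<1$ for all $x\ge 0$, and let $R_1,R_2,\ldots$ be the corresponding sequence of (upper) record values. Let $g$ be a real-valued function continuous on $[0,\infty)$ such that $g(v)\ne \bar g(0,v)$ for every $v>0$, where $\bar g(u,v)=\frac{1}{v-u}\int_u^v g(t)\,dt$. Then $F$ is exponential, i.e. there is a constant $c>0$ such that $$F(x)=1-e^{-cx}\qquad (x\ge 0),$$ if and only if for all $0\le u<v<\infty$ $$E\left[\frac{g(R_2)+g(R_3)+\cdots+g(R_n)}{n-1}\,\Big|\, R_1=u,\ R_{n+1}=v\right]=\bar g(u,v).$$
   Context: Record times and record values: $T_1=1$ and $T_n=\min\{j: X_j>X_{T_{n-1}},\ j>T_{n-1}\}$ for $n>1$; the record values are $R_n=X_{T_n}$, $n=1,2,\ldots$. Cumulative hazard function and hazard rate: $H(x)=-\ln(1-F(x))$ for $x\ge 0$, and $h(x)=H'(x)$ (defined almost everywhere). The conditional expectation given $R_1=u$, $R_{n+1}=v$ is understood pointwise, computed from the conditional densities of $R_j$ given $R_1=u$, $R_{n+1}=v$, which for $2\le j\le n$ and $u<t<v$ are $$f_{j|1,n+1}(t|u,v)=\frac{(n-1)!}{(j-2)!\,(n-j)!}\left[\frac{H(t)-H(u)}{H(v)-H(u)}\right]^{j-2}\left[\frac{H(v)-H(t)}{H(v)-H(u)}\right]^{n-j}\frac{h(t)}{H(v)-H(u)};$$ so $E[\sum_{j=2}^n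 g(R_j)\mid R_1=u,R_{n+1}=v]=\int_u^v g(t)\sum_{j=2}^n f_{j|1,n+1}(t|u,v)\,dt$. The asserted identity for all $0\le u<v$ presupposes that these quantities are defined, i.e. $H(u)<H(v)$. *)

theory Defs
  imports "HOL-Probability.Probability"
begin

text \<open>
  Sequences \<open>x\<close> are indexed from 1, so \<open>x 0\<close> and \<open>record_time x 0\<close> play no role.
  If no further record occurs (a null event when \<open>F < 1\<close> everywhere), \<open>LEAST\<close> yields
  an unspecified number.
\<close>

fun record_time :: "(nat \<Rightarrow> real) \<Rightarrow> nat \<Rightarrow> nat" where
  "record_time x 0 = 0"
| "record_time x (Suc 0) = 1"
| "record_time x (Suc (Suc n)) =
     (LEAST j. j > record_time x (Suc n) \<and> x j > x (record_time x (Suc n)))"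

definition record_value :: "(nat \<Rightarrow> real) \<Rightarrow> nat \<Rightarrow> real" where
  "record_value x n = x (record_time x n)"

definition cum_hazard :: "(real \<Rightarrow> real) \<Rightarrow> real \<Rightarrow> real" where
  "cum_hazard F x = - ln (1 - F x)"

text \<open>
  For absolutely continuous \<open>F\<close> with \<open>F < 1\<close>, \<open>cum_hazard F\<close> is differentiable almost everywhere;
  on the remaining null set \<open>deriv\<close> is unspecified, which does not affect the integrals below.
\<close>

definition hazard_rate :: "(real \<Rightarrow> real) \<Rightarrow> real \<Rightarrow> real" where
  "hazard_rate F x = deriv (cum_hazard F) x"

text \<open>
  The pointwise version of the conditional density at \<open>t\<close> of the \<open>j\<close>-th record value
  of an i.i.d. sequence with distribution function \<open>F\<close>, given that the first record value is \<open>u\<close>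
  and the \<open>(n+1)\<close>-st is \<open>v\<close>, where \<open>2 \<le> j \<le> n\<close> and \<open>u < t < v\<close>.  Given these two values, the
  intermediate records are distributed like the order statistics of \<open>n - 1\<close> independent
  variables with distribution function \<open>(H(t) - H(u)) / (H(v) - H(u))\<close> on \<open>[u, v]\<close>, \<open>H\<close> being the
  cumulative hazard function; record \<open>j\<close> is the \<open>(j-1)\<close>-st of these order statistics.
  The formula is meaningful only if \<open>H(u) < H(v)\<close>.
\<close>

definition record_cond_density ::
  "(real \<Rightarrow> real) \<Rightarrow> nat \<Rightarrow> nat \<Rightarrow> real \<Rightarrow> real \<Rightarrow> real \<Rightarrow> real" where
  "record_cond_density F n j u v t =
     (let H = cum_hazard F; h = hazard_rate F in
      fact (n - 1) / (fact (j - 2) * fact (n - j))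
      * ((H t - H u) / (H v - H u)) ^ (j - 2)
      * ((H v - H t) / (H v - H u)) ^ (n - j)
      * (h t / (H v - H u)))"

text \<open>
  The conditional expectation of \<open>g(R\<^sub>2) + ... + g(R\<^sub>n)\<close> given \<open>R\<^sub>1 = u\<close> and \<open>R\<^sub>n\<^sub>+\<^sub>1 = v\<close>,
  where \<open>R\<^sub>j\<close> is the \<open>j\<close>-th record value, computed pointwise from the conditional densities.
\<close>

definition record_sum_cond_exp ::
  "(real \<Rightarrow> real) \<Rightarrow> nat \<Rightarrow> (real \<Rightarrow> real) \<Rightarrow> real \<Rightarrow> real \<Rightarrow> real" where
  "record_sum_cond_exp F n g u v =
     integral {u..v} (\<lambda>t. g t * (\<Sum>j=2..n. record_cond_density F n j u v t))"

definition interval_mean :: "(real \<Rightarrow> real) \<Rightarrow> real \<Rightarrow> real \<Rightarrow> real" where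
  "interval_mean g u v = 1 / (v - u) * integral {u..v} g"

end

theory Submission
  imports Defs
begin

text \<open>
  Write \<open>H\<close> for the cumulative hazard and \<open>h\<close> for its derivative.  Given the two outer
  records, the intermediate ones are the order statistics of \<open>n - 1\<close> independent points with
  distribution function \<open>(H t - H u) / (H v - H u)\<close>, so their
  conditional densities add up to \<open>n - 1\<close> times the density \<open>h t / (H v - H u)\<close> of a single
  sample point (\<open>sum_record_cond_density\<close>, which is the binomial
  theorem).  The regression condition thereby loses its dependence on \<open>n\<close>: it says that the
  \<open>h\<close>-weighted mean of \<open>g\<close> over every \<open>[u, v]\<close> equals the unweighted one,
  \[ \int_u^v g h = (H v - H u) \, \bar g(u, v). \]
  If \<open>H\<close> is linear on the half-line then \<open>h\<close> is constant and this is clear.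

  Conversely, the left-hand side is additive over adjacent intervals, hence so is the right-hand side.
  With \<open>G v = \<integral>\<^sub>0\<^sup>v g\<close> and \<open>H 0 = 0\<close>, additivity over \<open>[0, u]\<close> and \<open>[u, v]\<close> becomes
  \[ (u \, G v - v \, G u) \, (H v / v - H u / u) = 0. \]
  The derivative of \<open>G v / v\<close> is \<open>(g v - G v / v) / v\<close>, nonzero by the hypothesis on \<open>g\<close>;
  by Rolle's theorem \<open>v \<mapsto> G v / v\<close> is injective (\<open>interval_mean_inj\<close>).  So the first factor
  is nonzero for \<open>u \<noteq> v\<close>, \<open>H v / v\<close> is constant, and \<open>F = 1 - exp (- H)\<close> is exponential.

  Additivity needs \<open>g h\<close> to be integrable.  This too comes out of the regression condition, by a
  second use of injectivity (\<open>linear_of_weighted_mean_eq_interval_mean\<close>).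
\<close>

section \<open>The mixture of the conditional record densities\<close>

lemma sum_order_statistic_weights:
  fixes p q :: real
  assumes "n \<ge> 2" "p + q = 1"
  shows "(\<Sum>j=2..n. fact (n - 1) / (fact (j - 2) * fact (n - j)) * p ^ (j - 2) * q ^ (n - j))
         = real n - 1"
proof -
  define m where "m = n - 2"
  have n: "n = m + 2" using assms by (simp add: m_def)
  have "(\<Sum>j=2..n. fact (n - 1) / (fact (j - 2) * fact (n - j)) * p ^ (j - 2) * q ^ (n - j))
      = (\<Sum>k\<le>m. fact (m + 1) / (fact k * fact (m - k)) * p ^ k * q ^ (m - k))"
    by (rule sum.reindex_bij_witness[of _ "\<lambda>k. k + 2" "\<lambda>j. j - 2"]) (auto simp: n)
  also have "\<dots> = (\<Sum>k\<le>m. (real m + 1) * (real (m choose k) * p ^ k * q ^ (m - k)))"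
    by (rule sum.cong) (auto simp: binomial_fact field_simps)
  also have "\<dots> = (real m + 1) * (p + q) ^ m"
    by (simp add: binomial_ring sum_distrib_left)
  finally show ?thesis using assms n by simp
qed

lemma sum_record_cond_density:
  assumes "n \<ge> 2" "cum_hazard F u < cum_hazard F v"
  shows "(\<Sum>j=2..n. record_cond_density F n j u v t)
         = (real n - 1) * (hazard_rate F t / (cum_hazard F v - cum_hazard F u))"
proof -
  define d where "d = cum_hazard F v - cum_hazard F u"
  have "(cum_hazard F t - cum_hazard F u) / d + (cum_hazard F v - cum_hazard F t) / d = 1"
    using assms by (simp add: d_def add_divide_distrib[symmetric])
  from sum_order_statistic_weights[OF assms(1) this] show ?thesis
    unfolding record_cond_density_def Let_def d_def by (simp only: sum_distrib_right[symmetric])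
qed

lemma record_mean_cond_exp_eq_hazard_mean:
  assumes "n \<ge> 2" "cum_hazard F u < cum_hazard F v"
  shows "record_sum_cond_exp F n g u v / (real n - 1)
         = integral {u..v} (\<lambda>t. g t * hazard_rate F t) / (cum_hazard F v - cum_hazard F u)"
proof -
  define d where "d = cum_hazard F v - cum_hazard F u"
  have "record_sum_cond_exp F n g u v
      = integral {u..v} (\<lambda>t. (real n - 1) / d * (g t * hazard_rate F t))"
    unfolding record_sum_cond_exp_def sum_record_cond_density[OF assms] d_def
    by (rule arg_cong[where f = "integral _"]) (auto simp: fun_eq_iff)
  also have "\<dots> = (real n - 1) / d * integral {u..v} (\<lambda>t. g t * hazard_rate F t)"
    by (rule integral_mult_right)
  finally show ?thesis using assms by (simp add: d_def)
qed

section \<open>Exponential distributions satisfy the regression condition\<close>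

lemma exponential_imp_hazard_mean_eq:
  assumes c: "c > 0" and F: "\<And>x. x \<ge> 0 \<Longrightarrow> F x = 1 - exp (- c * x)" and uv: "0 \<le> u" "u < v"
  shows "cum_hazard F u < cum_hazard F v"
    and "integral {u..v} (\<lambda>t. g t * hazard_rate F t) / (cum_hazard F v - cum_hazard F u)
         = interval_mean g u v"
proof -
  have H: "cum_hazard F x = c * x" if "x \<ge> 0" for x
    using F[OF that] by (simp add: cum_hazard_def)
  show "cum_hazard F u < cum_hazard F v" using uv c by (simp add: H)
  have h: "hazard_rate F t = c" if "t > 0" for t
  proof -
    have "(cum_hazard F has_real_derivative c) (at t)"
    proof (rule has_field_derivative_transform_within_open[where S = "{0<..}"])
      show "((*) c has_real_derivative c) (at t)" by (auto intro!: derivative_eq_intros)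
    qed (use that in \<open>auto simp: H\<close>)
    then show ?thesis unfolding hazard_rate_def by (rule DERIV_imp_deriv)
  qed
  \<comment> \<open>At \<open>t = 0\<close> the formula for \<open>F\<close> determines only the right derivative of the cumulative
      hazard, so that point has to be discarded.\<close>
  have "integral {u..v} (\<lambda>t. g t * hazard_rate F t) = integral {u..v} (\<lambda>t. c * g t)"
    by (rule integral_spike[of "{0}"]) (use uv h in auto)
  also have "\<dots> = c * integral {u..v} g" by (rule integral_mult_right)
  finally show "integral {u..v} (\<lambda>t. g t * hazard_rate F t) / (cum_hazard F v - cum_hazard F u)
      = interval_mean g u v"
    using uv c by (simp add: H interval_mean_def right_diff_distrib[symmetric])
qed

section \<open>The regression condition forces a linear cumulative hazard\<close>

text \<open>
  Equal means at two points would, by Rolle's theorem, produce a critical point of the mean, and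
  the critical points are exactly those \<open>v\<close> with \<open>g v = interval_mean g 0 v\<close>.
\<close>
lemma interval_mean_inj:
  assumes cont: "continuous_on {0..} g"
    and neq: "\<And>v. v > 0 \<Longrightarrow> g v \<noteq> interval_mean g 0 v"
    and ab: "0 < a" "a < b"
  shows "interval_mean g 0 a \<noteq> interval_mean g 0 b"
proof
  assume eq: "interval_mean g 0 a = interval_mean g 0 b"
  have G: "((\<lambda>v. integral {0..v} g) has_real_derivative g x) (at x)" if "x > 0" for x
  proof -
    have "((\<lambda>v. integral {0..v} g) has_real_derivative g x) (at x within {0..x + 1})"
      by (rule integral_has_real_derivative)
         (use that in \<open>auto intro: continuous_on_subset[OF cont]\<close>)
    moreover have "at x within {0..x + 1} = at x"
      by (rule at_within_interior) (use that in auto)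
    ultimately show ?thesis by simp
  qed
  have D: "(interval_mean g 0 has_real_derivative (g x - interval_mean g 0 x) / x) (at x)"
    if "x > 0" for x
    unfolding interval_mean_def
    by (rule derivative_eq_intros G[OF that] refl | use that in \<open>simp add: field_simps\<close>)+
  have "\<exists>z>a. z < b \<and> (*) ((g z - interval_mean g 0 z) / z) = (\<lambda>v. 0)"
  proof (rule Rolle_deriv[OF ab(2) eq])
    show "continuous_on {a..b} (interval_mean g 0)"
      by (rule DERIV_continuous_on[where D = "\<lambda>x. (g x - interval_mean g 0 x) / x"])
         (use ab in \<open>auto intro!: has_field_derivative_at_within D\<close>)
    show "(interval_mean g 0 has_derivative (*) ((g x - interval_mean g 0 x) / x)) (at x)"
      if "a < x" "x < b" for x
      using D[of x] that ab by (simp add: has_field_derivative_def)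
  qed
  then obtain z where z: "a < z" "(*) ((g z - interval_mean g 0 z) / z) = (\<lambda>v. 0)" by blast
  from fun_cong[OF z(2), of 1] show False using neq[of z] z(1) ab by simp
qed

text \<open>
  The factorisation behind the converse direction: \<open>a\<close>, \<open>b\<close> stand for the means of \<open>g\<close> over
  \<open>[0, u]\<close> and \<open>[0, v]\<close>, and \<open>P\<close>, \<open>Q\<close> for the values of \<open>H\<close> at \<open>u\<close> and \<open>v\<close>.
\<close>
lemma proportional_of_additive:
  fixes u v a b P Q :: real
  assumes uv: "0 < u" "u < v"
    and add: "P * a + (Q - P) * ((b * v - a * u) / (v - u)) = Q * b"
    and ab: "a \<noteq> b"
  shows "P / u = Q / v"
proof -
  have "(v - u) * (P * a) + (Q - P) * (b * v - a * u) = (v - u) * (Q * b)"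
    using arg_cong[OF add, of "(*) (v - u)"] uv by (simp add: distrib_left)
  then have "(b - a) * (u * Q - v * P) = 0" by (simp add: algebra_simps)
  then have "u * Q = v * P" using ab by simp
  then show ?thesis using uv by (simp add: field_simps)
qed

text \<open>
  The condition gives \<open>H x / x\<close> the same value at any two points, by the factorisation above, once
  the integral of \<open>g h\<close> can be split.  If \<open>g h\<close> were not integrable on some \<open>[0, w]\<close>, then its integral over all longer intervals
  would take the default value \<open>0\<close> as well, which makes the mean of \<open>g\<close> vanish from \<open>w\<close> on and
  contradicts injectivity.
\<close>
lemma linear_of_weighted_mean_eq_interval_mean:
  fixes H h g :: "real \<Rightarrow> real"
  assumes H0: "H 0 = 0"
    and mono: "\<And>u v. 0 \<le> u \<Longrightarrow> u < v \<Longrightarrow> H u < H v"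
    and mean: "\<And>u v. 0 \<le> u \<Longrightarrow> u < v \<Longrightarrow>
                 integral {u..v} (\<lambda>t. g t * h t) / (H v - H u) = interval_mean g u v"
    and cont: "continuous_on {0..} g"
    and neq: "\<And>v. v > 0 \<Longrightarrow> g v \<noteq> interval_mean g 0 v"
    and x: "x \<ge> 0"
  shows "H x = H 1 * x"
proof -
  define f where "f = (\<lambda>t. g t * h t)"
  have inj: "interval_mean g 0 a \<noteq> interval_mean g 0 b" if "0 < a" "a < b" for a b
    using interval_mean_inj[OF cont neq that] .
  have f: "integral {u..v} f = (H v - H u) * interval_mean g u v" if "0 \<le> u" "u < v" for u v
    using mean[OF that] mono[OF that] unfolding f_def by (simp add: divide_eq_eq mult.commute)
  have integrable: "f integrable_on {0..w}" if "w > 0" for w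
  proof (rule ccontr)
    assume not: "\<not> f integrable_on {0..w}"
    have "interval_mean g 0 y = 0" if "y \<ge> w" for y
    proof -
      have "\<not> f integrable_on {0..y}"
        using not integrable_subinterval_real[of f 0 y 0 w] that by auto
      then have "integral {0..y} f = 0" by (rule not_integrable_integral)
      then show ?thesis using f[of 0 y] mono[of 0 y] \<open>w > 0\<close> that by auto
    qed
    then show False using inj[of w "w + 1"] that by simp
  qed
  have step: "H u / u = H v / v" if uv: "0 < u" "u < v" for u v
  proof (rule proportional_of_additive[OF uv])
    have split: "integral {0..v} g = integral {0..u} g + integral {u..v} g"
      by (rule Henstock_Kurzweil_Integration.integral_combine[symmetric])
         (use uv in \<open>auto intro!: integrable_continuous_interval continuous_on_subset[OF cont]\<close>)
    have "integral {0..u} f + integral {u..v} f = integral {0..v} f"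
      by (rule Henstock_Kurzweil_Integration.integral_combine) (use uv integrable in auto)
    then show "H u * interval_mean g 0 u
        + (H v - H u) * ((interval_mean g 0 v * v - interval_mean g 0 u * u) / (v - u))
        = H v * interval_mean g 0 v"
      using f[of 0 u] f[of u v] f[of 0 v] uv by (simp add: interval_mean_def H0 split)
    show "interval_mean g 0 u \<noteq> interval_mean g 0 v" using inj[OF uv] .
  qed
  consider "x = 0" | "x = 1" | "0 < x" "x < 1" | "1 < x" using x by linarith
  then show ?thesis
  proof cases
    case 3
    then show ?thesis using step[of x 1] by (simp add: field_simps)
  next
    case 4
    then show ?thesis using step[of 1 x] by (simp add: field_simps)
  qed (simp_all add: H0)
qed

section \<open>Characterisation of the exponential distribution\<close>

theorem theorem1:
  fixes M :: "'a measure"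
    and X R :: "nat \<Rightarrow> 'a \<Rightarrow> real"
    and F g :: "real \<Rightarrow> real"
    and n :: nat
  assumes "n \<ge> 2"
    and "prob_space M"
    and "prob_space.indep_vars M (\<lambda>_. borel) X {1..}"
    and "\<And>i. i \<ge> 1 \<Longrightarrow> cdf (distr M borel (X i)) = F"
    and "absolutely_continuous lborel (distr M borel (X 1))"
    and "F 0 = 0"
    and "\<And>x. x \<ge> 0 \<Longrightarrow> F x < 1"
    and "\<And>k \<omega>. R k \<omega> = record_value (\<lambda>i. X i \<omega>) k"
    and "continuous_on {0..} g"
    and "\<And>v. v > 0 \<Longrightarrow> g v \<noteq> interval_mean g 0 v"
  shows "(\<exists>c>0. \<forall>x\<ge>0. F x = 1 - exp (- c * x)) \<longleftrightarrow>
         (\<forall>u v. 0 \<le> u \<and> u < v \<longrightarrow>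
            cum_hazard F u < cum_hazard F v \<and>
            record_sum_cond_exp F n g u v / (real n - 1) = interval_mean g u v)"
proof
  assume "\<exists>c>0. \<forall>x\<ge>0. F x = 1 - exp (- c * x)"
  then obtain c where "c > 0" "\<And>x. x \<ge> 0 \<Longrightarrow> F x = 1 - exp (- c * x)" by blast
  note exponential_imp_hazard_mean_eq[OF this]
  then show "\<forall>u v. 0 \<le> u \<and> u < v \<longrightarrow>
      cum_hazard F u < cum_hazard F v \<and>
      record_sum_cond_exp F n g u v / (real n - 1) = interval_mean g u v"
    by (simp add: record_mean_cond_exp_eq_hazard_mean[OF assms(1)])
next
  assume cond: "\<forall>u v. 0 \<le> u \<and> u < v \<longrightarrow>
      cum_hazard F u < cum_hazard F v \<and>
      record_sum_cond_exp F n g u v / (real n - 1) = interval_mean g u v"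
  define c where "c = cum_hazard F 1"
  have H0: "cum_hazard F 0 = 0" using assms(6) by (simp add: cum_hazard_def)
  have H: "cum_hazard F x = c * x" if "x \<ge> 0" for x
    unfolding c_def
  proof (rule linear_of_weighted_mean_eq_interval_mean
      [where H = "cum_hazard F" and h = "hazard_rate F" and g = g, OF H0 _ _ assms(9,10) that])
    fix u v :: real
    assume uv: "0 \<le> u" "u < v"
    show mono: "cum_hazard F u < cum_hazard F v" using cond uv by blast
    show "integral {u..v} (\<lambda>t. g t * hazard_rate F t) / (cum_hazard F v - cum_hazard F u)
        = interval_mean g u v"
      using cond uv record_mean_cond_exp_eq_hazard_mean[OF assms(1) mono, of g] by simp
  qed
  have "c > 0" using cond[rule_format, of 0 1] H0 by (simp add: c_def)
  moreover have "F x = 1 - exp (- c * x)" if "x \<ge> 0" for x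
  proof -
    have "ln (1 - F x) = - c * x" using H[OF that] by (simp add: cum_hazard_def)
    then have "exp (- c * x) = 1 - F x" using assms(7)[OF that] by (metis diff_gt_0_iff_gt exp_ln)
    then show ?thesis by simp
  qed
  ultimately show "\<exists>c>0. \<forall>x\<ge>0. F x = 1 - exp (- c * x)" by blast
qed

end
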